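(* Let $W_1(\mathbf x)=\omega_1(\rho),\dots,W_r(\mathbf x)=\omega_r(\rho)$ be radial weights. Let $\vec n=(n_1,\dots,n_r),\ \vec j=(j_1,\dots,j_r)\in\mathbb N_0^r$ be such that $0\le|\vec j|\le|\vec n|/2$, and consider the polynomials $$\mathbf A^{\vec n}_{\vec j,\nu,(l)}(\mathbf x)=q_{2\vec j,l}^{(2|\vec n|-4|\vec j|)}(\rho)\,Y_\nu^{|\vec n|-2|\vec j|}(\mathbf x),\qquad 1\le l\le r,\ \nu=1,\dots,\dim\mathbb H^d_{|\vec n|-2|\vec j|},$$ where $\{Y_\nu^{|\vec n|-2|\vec j|}:1\le\nu\le\dim\mathbb H^d_{|\vec n|-2|\vec j|}\}$ is a basis of $\mathbb H^d_{|\vec n|-2|\vec j|}$. Denote a $d$-variate monomial by $\mathbf x^{\mathbf a}=x_1^{a_1}\cdots x_d^{a_d}$. Then $$\int_{\mathbb R^2}\sum_{l=1}^r\mathbf A^{\vec n}_{\vec j,\nu,(l)}(\mathbf x)\,\mathbf x^{\mathbf a}\,W_l(\mathbf x)\,d\mathbf x=0\qquad\text{if }0\le|\mathbf a|<|\vec n|-1 .$$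
   Context: For a vector $v$ of nonnegative integers, $|v|$ is the sum of its components. $\mathbf x=(x_1,\dots,x_d)$ has spherical polar coordinates with radius $\rho=\|\mathbf x\|=\sqrt{x_1^2+\cdots+x_d^2}$. A weight function $W$ is radial if $W(\mathbf x)=\omega(\rho)=\omega(\sqrt{x_1^2+\cdots+x_d^2})$. The setting is that of radial weights supported on $\mathbb R^2$, while the notation is that of $d$ variables; the integral is over $\mathbb R^2$, so the displayed relation reads literally when $d=2$. $\mathbb H^d_M$ is the space of real homogeneous polynomials $P$ of degree $M$ in $d$ variables with $\Delta P=0$. For $k\ge0$ consider the system of weights $\rho^{k+1}\omega_1(\rho),\dots,\rho^{k+1}\omega_r(\rho)$ supported on $[0,+\infty)$. A multi-index $\vec v=(v_1,\dots,v_r)\in\mathbb N_0^r$ is normal for this system if both the Type I and the Type II multiple orthogonal polynomials exist. For normal $\vec v$, $q^{(k)}_{\vec v,l}$, $1\le l\le r$, denote the associated Type I multiple orthogonal polynomials: $\deg q^{(k)}_{\vec v,l}\le v_l-1$ (zero if $v_l=0$) and $$\sum_{l=1}^r\int_0^\infty q^{(k)}_{\vec v,l}(\rho)\,\rho^t\,\rho^{k+1}\omega_l(\rho)\,d\rho=\delta_{t,|\vec v|-1},\qquad 0\le t\le|\vec v|-1,$$ and the Type II one is a polynomial $p^{(k)}_{\vec v}$ of degree $|\vec v|$ with $\int_0^\infty p^{(k)}_{\vec v}(\rho)\,\rho^t\,\rho^{k+1}\omega_l(\rho)\,d\rho=0$ for $0\le t<v_l$, $1\le l\le r$. The multi-index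 $2\vec j$ is understood to be normal for the system with $k=2|\vec n|-4|\vec j|$. *)

theory Defs
  imports "HOL-Analysis.Analysis" "HOL-Library.Function_Algebras"
    "HOL-Computational_Algebra.Polynomial"
begin

text \<open>
  Functions with values in a real vector space form a real vector space under the pointwise
  operations. This makes \<^const>\<open>span\<close>, \<^const>\<open>independent\<close> and \<^const>\<open>dim\<close> available for spaces of
  polynomial functions.
\<close>

instantiation "fun" :: (type, real_vector) real_vector
begin

definition scaleR_fun :: "real \<Rightarrow> ('a \<Rightarrow> 'b) \<Rightarrow> 'a \<Rightarrow> 'b"
  where "scaleR_fun c f = (\<lambda>x. c *\<^sub>R f x)"

instance
  by standard (simp_all add: scaleR_fun_def fun_eq_iff scaleR_add_right scaleR_add_left)

end

definition vec_size :: "nat ^ 'm \<Rightarrow> nat"  (\<open>\<bar>_\<bar>\<^sub>v\<close>)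
  where "\<bar>v\<bar>\<^sub>v = (\<Sum>i\<in>UNIV. v $ i)"

definition monomial :: "nat ^ 'd \<Rightarrow> real ^ 'd \<Rightarrow> real"
  where "monomial a x = (\<Prod>i\<in>UNIV. (x $ i) ^ (a $ i))"

text \<open>
  Since \<open>\<real>\<close> is infinite, a real polynomial is determined by its polynomial function;
  homogeneous polynomials are represented by these functions.
\<close>

definition homogeneous_polynomials :: "nat \<Rightarrow> (real ^ 'd \<Rightarrow> real) set"
  where "homogeneous_polynomials M = span {monomial a | a. \<bar>a\<bar>\<^sub>v = M}"

definition partial_deriv :: "'d \<Rightarrow> (real ^ 'd \<Rightarrow> real) \<Rightarrow> real ^ 'd \<Rightarrow> real"
  where "partial_deriv i f x = deriv (\<lambda>t. f (x + t *\<^sub>R axis i 1)) 0"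

definition laplacian :: "(real ^ 'd \<Rightarrow> real) \<Rightarrow> real ^ 'd \<Rightarrow> real"
  where "laplacian f x = (\<Sum>i\<in>UNIV. partial_deriv i (partial_deriv i f) x)"

definition harmonic_polynomials :: "nat \<Rightarrow> (real ^ 'd \<Rightarrow> real) set"
  where "harmonic_polynomials M = {P \<in> homogeneous_polynomials M. \<forall>x. laplacian P x = 0}"

definition is_basis_family :: "(nat \<Rightarrow> 'v::real_vector) \<Rightarrow> nat set \<Rightarrow> 'v set \<Rightarrow> bool"
  where "is_basis_family Y I V \<longleftrightarrow> inj_on Y I \<and> independent (Y ` I) \<and> span (Y ` I) = V"

text \<open>
  Every polynomial has to be integrable against a weight function. No sign condition is imposed.
\<close>

definition weight_function :: "(real ^ 'd \<Rightarrow> real) \<Rightarrow> bool"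
  where "weight_function W \<longleftrightarrow> (\<forall>a. integrable lborel (\<lambda>x. monomial a x * W x))"

definition radial_weight :: "(real ^ 'd \<Rightarrow> real) \<Rightarrow> (real \<Rightarrow> real) \<Rightarrow> bool"
  where "radial_weight W \<omega> \<longleftrightarrow> weight_function W \<and> (\<forall>x. W x = \<omega> (norm x))"

text \<open>
  In the following, \<open>w\<close> is a system of univariate weights on \<open>{0..}\<close>, indexed by a finite type.
\<close>

definition is_type_I :: "('r::finite \<Rightarrow> real \<Rightarrow> real) \<Rightarrow> nat ^ 'r \<Rightarrow> ('r \<Rightarrow> real poly) \<Rightarrow> bool"
  where "is_type_I w v q \<longleftrightarrow>
    (\<forall>l. if v $ l = 0 then q l = 0 else degree (q l) \<le> v $ l - 1) \<and>
    (\<forall>t<\<bar>v\<bar>\<^sub>v. (\<Sum>l\<in>UNIV. LINT \<rho>:{0..}|lborel. poly (q l) \<rho> * \<rho> ^ t * w l \<rho>)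
              = (if t = \<bar>v\<bar>\<^sub>v - 1 then 1 else 0))"

definition is_type_II :: "('r::finite \<Rightarrow> real \<Rightarrow> real) \<Rightarrow> nat ^ 'r \<Rightarrow> real poly \<Rightarrow> bool"
  where "is_type_II w v p \<longleftrightarrow>
    p \<noteq> 0 \<and> degree p = \<bar>v\<bar>\<^sub>v \<and>
    (\<forall>l. \<forall>t<v $ l. (LINT \<rho>:{0..}|lborel. poly p \<rho> * \<rho> ^ t * w l \<rho>) = 0)"

definition normal_index :: "('r::finite \<Rightarrow> real \<Rightarrow> real) \<Rightarrow> nat ^ 'r \<Rightarrow> bool"
  where "normal_index w v \<longleftrightarrow> (\<exists>q. is_type_I w v q) \<and> (\<exists>p. is_type_II w v p)"

definition shifted_system :: "('r \<Rightarrow> real \<Rightarrow> real) \<Rightarrow> nat \<Rightarrow> 'r \<Rightarrow> real \<Rightarrow> real"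
  where "shifted_system \<omega> k l \<rho> = \<rho> ^ (k + 1) * \<omega> l \<rho>"

end

theory Submission
  imports Defs "HOL-Probability.Distributions"
begin

text \<open>
  By homogeneity, the integral of \<open>\<phi>(\<rho>) P(x)\<close> with \<open>P\<close> homogeneous of degree \<open>M\<close> in \<open>d\<close> variables
  is a constant depending only on \<open>P\<close> times the integral of \<open>\<phi>(\<rho>) \<rho>^(M + d - 1)\<close> over \<open>[0, \<infinity>)\<close>.
  Take \<open>P = Y x^a\<close> with \<open>Y\<close> harmonic of degree \<open>m = |n| - 2|j|\<close>, and \<open>d = 2\<close>.
  If \<open>|a| < m\<close>, the constant is \<open>0\<close>: this can be tested with Gaussian \<open>\<phi>\<close>, where it follows from
  integration by parts and Euler's identity.
  If \<open>|a| \<ge> m\<close>, the radial integrals are those of the Type I relation with exponent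
  \<open>t = |a| - m < 2|j| - 1\<close>, so their sum vanishes.
\<close>

section \<open>Polynomial functions and homogeneous polynomials\<close>

abbreviation polynomial_functions :: "(real ^ 'd \<Rightarrow> real) set"
  where "polynomial_functions \<equiv> span (range monomial)"

lemma monomial_mult: "monomial a x * monomial b x = monomial (a + b) x"
  by (simp add: monomial_def power_add prod.distrib)

lemma vec_size_add: "\<bar>a + b\<bar>\<^sub>v = \<bar>a\<bar>\<^sub>v + \<bar>b\<bar>\<^sub>v"
  by (simp add: vec_size_def sum.distrib)

lemma vec_size_axis [simp]: "\<bar>axis i k\<bar>\<^sub>v = k"
  by (simp add: vec_size_def axis_def)

lemma vec_size_minus_axis:
  assumes "a $ i \<noteq> 0"
  shows "\<bar>a - axis i 1\<bar>\<^sub>v = \<bar>a\<bar>\<^sub>v - 1"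
proof -
  have "a = (a - axis i 1) + axis i 1"
    using assms by (auto simp: vec_eq_iff axis_def)
  then have "\<bar>a\<bar>\<^sub>v = \<bar>a - axis i 1\<bar>\<^sub>v + 1"
    by (metis vec_size_add vec_size_axis)
  then show ?thesis
    by simp
qed

lemma monomial_axis: "monomial (axis i k) x = x $ i ^ k"
proof -
  have "monomial (axis i k) x = (\<Prod>l\<in>UNIV. if l = i then x $ i ^ k else 1)"
    unfolding monomial_def by (intro prod.cong) (auto simp: axis_def)
  then show ?thesis
    by simp
qed

text \<open>The product is linear in each factor separately, so two nested span inductions leave
  only products of generators. Applied to monomials, where a product of generators is again a
  generator.\<close>

lemma span_mult_closed:
  fixes f g :: "'a \<Rightarrow> real"
  assumes f: "f \<in> span S" and g: "g \<in> span T"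
    and ST: "\<And>s t. s \<in> S \<Longrightarrow> t \<in> T \<Longrightarrow> (\<lambda>x. s x * t x) \<in> span U"
  shows "(\<lambda>x. f x * g x) \<in> span U"
proof (rule span_induct[OF f])
  fix s assume s: "s \<in> S"
  show "(\<lambda>x. s x * g x) \<in> span U"
  proof (rule span_induct[OF g])
    show "subspace {g. (\<lambda>x. s x * g x) \<in> span U}"
    proof (intro subspaceI CollectI; (elim CollectE)?)
      show "(\<lambda>x. s x * (0 :: 'a \<Rightarrow> real) x) \<in> span U"
        using span_zero[of U] by (simp add: zero_fun_def)
    next
      fix u v assume "(\<lambda>x. s x * u x) \<in> span U" "(\<lambda>x. s x * v x) \<in> span U"
      from span_add[OF this] show "(\<lambda>x. s x * (u + v) x) \<in> span U"
        by (simp add: plus_fun_def distrib_left)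
    next
      fix c u assume "(\<lambda>x. s x * u x) \<in> span U"
      from span_scale[OF this, of c] show "(\<lambda>x. s x * (c *\<^sub>R u) x) \<in> span U"
        by (simp add: scaleR_fun_def mult_ac)
    qed
  qed (use s ST in auto)
next
  show "subspace {f. (\<lambda>x. f x * g x) \<in> span U}"
  proof (intro subspaceI CollectI; (elim CollectE)?)
    show "(\<lambda>x. (0 :: 'a \<Rightarrow> real) x * g x) \<in> span U"
      using span_zero[of U] by (simp add: zero_fun_def)
  next
    fix u v assume "(\<lambda>x. u x * g x) \<in> span U" "(\<lambda>x. v x * g x) \<in> span U"
    from span_add[OF this] show "(\<lambda>x. (u + v) x * g x) \<in> span U"
      by (simp add: plus_fun_def distrib_right)
  next
    fix c u assume "(\<lambda>x. u x * g x) \<in> span U"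
    from span_scale[OF this, of c] show "(\<lambda>x. (c *\<^sub>R u) x * g x) \<in> span U"
      by (simp add: scaleR_fun_def mult_ac)
  qed
qed

lemma monomial_in_homogeneous: "\<bar>a\<bar>\<^sub>v = M \<Longrightarrow> monomial a \<in> homogeneous_polynomials M"
  unfolding homogeneous_polynomials_def by (rule span_base) auto

lemma homogeneous_mult:
  assumes "f \<in> homogeneous_polynomials M" "g \<in> homogeneous_polynomials N"
  shows "(\<lambda>x. f x * g x) \<in> homogeneous_polynomials (M + N)"
  using assms unfolding homogeneous_polynomials_def
  by (rule span_mult_closed)
     (auto simp: monomial_mult vec_size_add intro!: span_base)

lemma polynomial_mult:
  assumes "f \<in> polynomial_functions" "g \<in> polynomial_functions"
  shows "(\<lambda>x. f x * g x) \<in> polynomial_functions"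
  using assms by (rule span_mult_closed) (auto simp: monomial_mult intro!: span_base)

lemma homogeneous_imp_polynomial:
  "f \<in> homogeneous_polynomials M \<Longrightarrow> f \<in> polynomial_functions"
  unfolding homogeneous_polynomials_def by (erule rev_subsetD) (intro span_mono, auto)

lemma polynomial_component: "(\<lambda>x. x $ i) \<in> polynomial_functions"
proof -
  have "(\<lambda>x :: real ^ 'a. x $ i) = monomial (axis i 1)"
    by (simp add: fun_eq_iff monomial_axis)
  then show ?thesis
    by (auto intro: span_base)
qed

lemma sum_fun_apply: "(\<Sum>i\<in>I. f i) x = (\<Sum>i\<in>I. f i x)"
  by (induction I rule: infinite_finite_induct) simp_all

lemma polynomial_sum:
  assumes "\<And>i. i \<in> I \<Longrightarrow> f i \<in> polynomial_functions"
  shows "(\<lambda>x. \<Sum>i\<in>I. f i x) \<in> polynomial_functions"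
proof -
  have "(\<lambda>x. \<Sum>i\<in>I. f i x) = (\<Sum>i\<in>I. f i)"
    by (rule ext) (rule sum_fun_apply[symmetric])
  then show ?thesis
    using assms by (simp add: span_sum)
qed

lemma polynomial_power:
  "f \<in> polynomial_functions \<Longrightarrow> (\<lambda>x. f x ^ k) \<in> polynomial_functions"
proof (induction k)
  case 0
  have "(\<lambda>x :: real ^ 'a. 1) = monomial 0"
    by (simp add: fun_eq_iff monomial_def)
  then show ?case
    by (auto intro: span_base)
next
  case (Suc k)
  then show ?case
    by (simp add: polynomial_mult)
qed

lemma polynomial_continuous_on:
  assumes "f \<in> polynomial_functions"
  shows "continuous_on S f"
proof (rule span_induct[OF assms])
  show "subspace {f :: real ^ 'a \<Rightarrow> real. continuous_on S f}"
    by (rule subspaceI)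
       (auto simp: zero_fun_def plus_fun_def scaleR_fun_def intro!: continuous_intros)
next
  fix f :: "real ^ 'a \<Rightarrow> real" assume "f \<in> range monomial"
  then obtain a where f: "f = monomial a" by auto
  show "continuous_on S f"
    unfolding f monomial_def[abs_def] by (intro continuous_intros)
qed

lemma homogeneous_scaleR:
  assumes "f \<in> homogeneous_polynomials M"
  shows "f (c *\<^sub>R x) = c ^ M * f x"
proof (rule span_induct[OF assms[unfolded homogeneous_polynomials_def]])
  show "subspace {f. f (c *\<^sub>R x) = c ^ M * f x}"
    by (rule subspaceI) (auto simp: scaleR_fun_def algebra_simps)
next
  fix f :: "real ^ 'a \<Rightarrow> real" assume "f \<in> {monomial a |a. \<bar>a\<bar>\<^sub>v = M}"
  then obtain a where "f = monomial a" "\<bar>a\<bar>\<^sub>v = M" by auto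
  then show "f (c *\<^sub>R x) = c ^ M * f x"
    by (auto simp: monomial_def power_mult_distrib prod.distrib vec_size_def power_sum)
qed

section \<open>Partial derivatives of polynomials and Euler's identity\<close>

text \<open>\<open>deriv\<close> is a total choice operator, so \<open>partial_deriv\<close> is
  known to be linear only where derivatives exist. The relation records existence together with the
  value and is closed under linear combinations, which is the form that span induction can
  use.\<close>

definition has_partial :: "'d \<Rightarrow> (real ^ 'd \<Rightarrow> real) \<Rightarrow> (real ^ 'd \<Rightarrow> real) \<Rightarrow> bool"
  where "has_partial i f g \<longleftrightarrow>
    (\<forall>x. ((\<lambda>t. f (x + t *\<^sub>R axis i 1)) has_real_derivative g x) (at 0))"

lemma has_partial_imp_partial_deriv: "has_partial i f g \<Longrightarrow> partial_deriv i f = g"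
  by (auto simp: has_partial_def partial_deriv_def fun_eq_iff intro!: DERIV_imp_deriv)

lemma has_partial_zero: "has_partial i 0 0"
  by (simp add: has_partial_def zero_fun_def)

lemma has_partial_add: "has_partial i f f' \<Longrightarrow> has_partial i g g' \<Longrightarrow> has_partial i (f + g) (f' + g')"
  by (auto simp: has_partial_def intro: DERIV_add)

lemma has_partial_scaleR: "has_partial i f f' \<Longrightarrow> has_partial i (c *\<^sub>R f) (c *\<^sub>R f')"
  by (auto simp: has_partial_def scaleR_fun_def intro: DERIV_cmult)

lemma has_partial_mult:
  assumes "has_partial i f f'" "has_partial i g g'"
  shows "has_partial i (\<lambda>x. f x * g x) (\<lambda>x. f' x * g x + f x * g' x)"
  unfolding has_partial_def
proof
  fix x
  show "((\<lambda>t. f (x + t *\<^sub>R axis i 1) * g (x + t *\<^sub>R axis i 1)) has_real_derivative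
      f' x * g x + f x * g' x) (at 0)"
    using assms[unfolded has_partial_def, THEN spec, of x]
    by (auto intro!: derivative_eq_intros)
qed

lemma monomial_split: "monomial a x = x $ i ^ (a $ i) * (\<Prod>l\<in>UNIV - {i}. x $ l ^ (a $ l))"
  unfolding monomial_def by (subst prod.remove[of UNIV i]) auto

text \<open>Along the line in direction \<open>i\<close> only the factor with index \<open>i\<close>
  varies; the others form the constant \<open>R\<close>. If \<open>a $ i = 0\<close>, the exponent
  in \<open>a - axis i 1\<close> is truncated, but the coefficient is then 0.\<close>

lemma has_partial_monomial:
  "has_partial i (monomial a) (real (a $ i) *\<^sub>R monomial (a - axis i 1))"
  unfolding has_partial_def
proof
  fix x :: "real ^ 'a"
  define R where "R = (\<Prod>l\<in>UNIV - {i}. x $ l ^ (a $ l))"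
  have 1: "monomial a (x + t *\<^sub>R axis i 1) = (x $ i + t) ^ (a $ i) * R" for t
    unfolding monomial_split[of _ _ i] R_def
    by (intro arg_cong2[of _ _ _ _ "(*)"] prod.cong) (auto simp: axis_def)
  have 2: "monomial (a - axis i 1) x = x $ i ^ (a $ i - 1) * R"
    unfolding monomial_split[of _ _ i] R_def
    by (intro arg_cong2[of _ _ _ _ "(*)"] prod.cong) (auto simp: axis_def)
  show "((\<lambda>t. monomial a (x + t *\<^sub>R axis i 1)) has_real_derivative
      (real (a $ i) *\<^sub>R monomial (a - axis i 1)) x) (at 0)"
    unfolding 1 scaleR_fun_def 2 by (auto intro!: derivative_eq_intros)
qed

text \<open>Having some partial derivative inside \<open>V\<close> is a property closed under linear
  combinations, so it passes from the generators to their span; uniqueness of derivatives then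
  identifies it with \<open>partial_deriv i f\<close>. Used with \<open>V\<close> the polynomial
  functions, the homogeneous polynomials of lower degree, and \<open>{0}\<close>.\<close>

lemma partial_deriv_span:
  assumes f: "f \<in> span S" and "subspace V"
    and S: "\<And>s. s \<in> S \<Longrightarrow> has_partial i s (partial_deriv i s) \<and> partial_deriv i s \<in> V"
  shows "has_partial i f (partial_deriv i f)" "partial_deriv i f \<in> V"
proof -
  have "\<exists>g\<in>V. has_partial i f g"
  proof (rule span_induct[OF f])
    show "subspace {f. \<exists>g\<in>V. has_partial i f g}"
    proof (intro subspaceI CollectI; (elim CollectE)?)
      show "\<exists>g\<in>V. has_partial i 0 g"
        using subspace_0[OF \<open>subspace V\<close>] has_partial_zero by blast
    qed (use assms(2) in \<open>meson subspace_add subspace_mul has_partial_add has_partial_scaleR\<close>)+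
  qed (use S in auto)
  then show "has_partial i f (partial_deriv i f)" "partial_deriv i f \<in> V"
    using has_partial_imp_partial_deriv by auto
qed

lemma partial_deriv_monomial:
  "partial_deriv i (monomial a) = real (a $ i) *\<^sub>R monomial (a - axis i 1)"
  by (rule has_partial_imp_partial_deriv[OF has_partial_monomial])

lemma
  fixes f :: "real ^ 'd \<Rightarrow> real"
  assumes "f \<in> polynomial_functions"
  shows has_partial_polynomial: "has_partial i f (partial_deriv i f)"
    and partial_deriv_polynomial: "partial_deriv i f \<in> polynomial_functions"
proof -
  have *: "has_partial i s (partial_deriv i s) \<and> partial_deriv i s \<in> polynomial_functions"
    if s: "s \<in> range monomial" for s
  proof -
    obtain a where "s = monomial a"
      using s by auto
    then show ?thesis
      using has_partial_monomial[of i a]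
      by (simp add: partial_deriv_monomial span_scale span_base del: One_nat_def)
  qed
  show "has_partial i f (partial_deriv i f)" "partial_deriv i f \<in> polynomial_functions"
    using partial_deriv_span[OF assms subspace_span *] by blast+
qed

lemma partial_deriv_homogeneous:
  assumes "f \<in> homogeneous_polynomials M"
  shows "partial_deriv i f \<in> homogeneous_polynomials (M - 1)"
  unfolding homogeneous_polynomials_def
proof (rule partial_deriv_span(2)[OF assms[unfolded homogeneous_polynomials_def] subspace_span], safe)
  fix a :: "nat ^ 'a"
  show "has_partial i (monomial a) (partial_deriv i (monomial a))"
    unfolding partial_deriv_monomial by (rule has_partial_monomial)
  show "partial_deriv i (monomial a) \<in> span {monomial b |b. \<bar>b\<bar>\<^sub>v = \<bar>a\<bar>\<^sub>v - 1}"
  \<comment> \<open>If the variable is absent, the derivative is 0 and lies in every span. This also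
    covers degree 0, where \<open>- 1\<close> is truncated.\<close>
  proof (cases "a $ i = 0")
    case True
    then show ?thesis by (simp add: partial_deriv_monomial span_zero)
  next
    case False
    then show ?thesis
      unfolding partial_deriv_monomial
      by (intro span_scale span_base) (use vec_size_minus_axis in blast)
  qed
qed

text \<open>On a monomial the operator \<open>x $ i * partial_deriv i\<close> multiplies by the
  exponent \<open>a $ i\<close>, and the exponents add up to \<open>M\<close>. The derivatives are
  quantified existentially as \<open>g\<close> so that differentiability is carried through the span
  induction.\<close>

lemma euler_homogeneous:
  assumes "f \<in> homogeneous_polynomials M"
  shows "(\<Sum>i\<in>UNIV. x $ i * partial_deriv i f x) = real M * f x"
proof -
  have "\<exists>g. (\<forall>i. has_partial i f (g i)) \<and> (\<Sum>i\<in>UNIV. x $ i * g i x) = real M * f x"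
  proof (rule span_induct[OF assms[unfolded homogeneous_polynomials_def]])
    show "subspace {f. \<exists>g. (\<forall>i. has_partial i f (g i)) \<and>
      (\<Sum>i\<in>UNIV. x $ i * g i x) = real M * f x}" (is "subspace {f. \<exists>g. ?P f g}")
    proof (intro subspaceI CollectI; (elim CollectE exE)?)
      show "\<exists>g. ?P 0 g"
        by (intro exI[of _ "\<lambda>_. 0"]) (simp add: has_partial_zero)
    next
      fix u v gu gv assume "?P u gu" "?P v gv"
      then show "\<exists>g. ?P (u + v) g"
        by (intro exI[of _ "\<lambda>i. gu i + gv i"])
           (simp add: has_partial_add distrib_left sum.distrib)
    next
      fix c u gu assume *: "?P u gu"
      then have "(\<Sum>i\<in>UNIV. x $ i * (c * gu i x)) = c * (real M * u x)"
        by (simp add: sum_distrib_left[symmetric] mult.left_commute[of _ c])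
      with * show "\<exists>g. ?P (c *\<^sub>R u) g"
        by (intro exI[of _ "\<lambda>i. c *\<^sub>R gu i"])
           (auto intro!: has_partial_scaleR, auto simp: scaleR_fun_def)
    qed
  next
    fix f :: "real ^ 'a \<Rightarrow> real" assume "f \<in> {monomial a |a. \<bar>a\<bar>\<^sub>v = M}"
    then obtain a where f: "f = monomial a" and a: "\<bar>a\<bar>\<^sub>v = M" by auto
    \<comment> \<open>Multiplication by \<open>x $ i\<close> restores the lowered exponent; for
      \<open>a $ i = 0\<close> both sides vanish.\<close>
    have "x $ i * (real (a $ i) * monomial (a - axis i 1) x) = real (a $ i) * monomial a x" for i
    proof (cases "a $ i")
      case (Suc k)
      then have "a = axis i 1 + (a - axis i 1)"
        by (auto simp: vec_eq_iff axis_def)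
      then have "monomial a x = x $ i * monomial (a - axis i 1) x"
        by (metis monomial_axis monomial_mult power_one_right)
      then show ?thesis by simp
    qed simp
    then have "(\<Sum>i\<in>UNIV. x $ i * (real (a $ i) *\<^sub>R monomial (a - axis i 1)) x) = real M * f x"
      unfolding f a[symmetric] vec_size_def scaleR_fun_def
      by (simp only: real_scaleR_def of_nat_sum sum_distrib_right)
    moreover have "\<forall>i. has_partial i f (real (a $ i) *\<^sub>R monomial (a - axis i 1))"
      unfolding f by (rule allI) (rule has_partial_monomial)
    ultimately have "(\<forall>i. has_partial i f (real (a $ i) *\<^sub>R monomial (a - axis i 1))) \<and>
        (\<Sum>i\<in>UNIV. x $ i * (real (a $ i) *\<^sub>R monomial (a - axis i 1)) x) = real M * f x"
      by (rule conjI[rotated])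
    then show "\<exists>g. (\<forall>i. has_partial i f (g i)) \<and> (\<Sum>i\<in>UNIV. x $ i * g i x) = real M * f x"
      by (rule exI[where x = "\<lambda>i. real (a $ i) *\<^sub>R monomial (a - axis i 1)"])
  qed
  then obtain g where "\<And>i. has_partial i f (g i)" "(\<Sum>i\<in>UNIV. x $ i * g i x) = real M * f x"
    by blast
  with has_partial_imp_partial_deriv[OF this(1)] show ?thesis
    by simp
qed

section \<open>Gaussian moments and integration by parts\<close>

lemma has_bochner_integral_lborel_prod:
  fixes f :: "'d::finite \<Rightarrow> real \<Rightarrow> real"
  assumes f: "\<And>i. integrable lborel (f i)"
  shows "has_bochner_integral lborel (\<lambda>x :: real ^ 'd. \<Prod>i\<in>UNIV. f i (x $ i))
           (\<Prod>i\<in>UNIV. LINT t|lborel. f i t)"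
proof -
  interpret product_sigma_finite "\<lambda>_ :: real ^ 'd. lborel :: real measure"
    by standard
  \<comment> \<open>\<open>lborel\<close> is the image of a product measure indexed by
    \<open>Basis\<close>. The bijection \<open>e\<close> from coordinates to basis vectors
    translates between that indexing and products over \<open>'d\<close>.\<close>
  define e :: "'d \<Rightarrow> real ^ 'd" where "e i = axis i 1" for i
  have inj: "inj e"
    by (auto simp: e_def inj_on_def axis_eq_axis)
  have Basis: "Basis = range e"
    by (auto simp: Basis_vec_def e_def)
  define F where "F b = f (inv e b)" for b
  have F: "integrable lborel (F b)" for b
    by (simp add: F_def f)
  have [measurable]: "f i \<in> borel_measurable borel" for i
    using f[of i] by auto
  have reindex: "(\<Prod>b\<in>Basis. h (inv e b) b) = (\<Prod>i\<in>UNIV. h i (e i))" for h :: "'d \<Rightarrow> real ^ 'd \<Rightarrow> real"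
    unfolding Basis by (subst prod.reindex) (auto simp: inj)
  have eq: "(\<Prod>b\<in>Basis. F b (g b)) = (\<Prod>i\<in>UNIV. f i ((\<Sum>b\<in>Basis. g b *\<^sub>R b) $ i))"
    for g :: "real ^ 'd \<Rightarrow> real"
  proof -
    have "(\<Sum>b\<in>Basis. g b *\<^sub>R b) $ i = g (e i)" for i
    proof -
      have "(\<Sum>b\<in>Basis. g b *\<^sub>R b) $ i = (\<Sum>b\<in>Basis. g b *\<^sub>R b) \<bullet> e i"
        by (simp add: e_def inner_axis)
      also have "\<dots> = g (e i)"
        by (rule inner_sum_left_Basis) (auto simp: Basis)
      finally show ?thesis .
    qed
    then show ?thesis
      using reindex[of "\<lambda>i b. f i (g b)"] by (simp add: F_def)
  qed
  have meas: "(\<lambda>g. \<Sum>b\<in>Basis. g b *\<^sub>R b) \<in> (\<Pi>\<^sub>M b\<in>Basis. lborel) \<rightarrow>\<^sub>M (borel :: (real ^ 'd) measure)"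
    by measurable
  have meas': "(\<lambda>x :: real ^ 'd. \<Prod>i\<in>UNIV. f i (x $ i)) \<in> borel_measurable borel"
    by measurable
  have "integrable (\<Pi>\<^sub>M b\<in>Basis. lborel) (\<lambda>g. \<Prod>b\<in>Basis. F b (g b))"
    by (rule product_integrable_prod) (auto simp: F)
  then have 1: "integrable lborel (\<lambda>x :: real ^ 'd. \<Prod>i\<in>UNIV. f i (x $ i))"
    unfolding eq lborel_eq[where 'a = "real ^ 'd"] integrable_distr_eq[OF meas meas'] .
  have "(LINT g|(\<Pi>\<^sub>M b\<in>Basis. lborel). (\<Prod>b\<in>Basis. F b (g b))) = (\<Prod>b\<in>Basis. LINT t|lborel. F b t)"
    by (rule product_integral_prod) (auto simp: F)
  also have "\<dots> = (\<Prod>i\<in>UNIV. LINT t|lborel. f i t)"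
    using reindex[of "\<lambda>i _. LINT t|lborel. f i t"] by (simp add: F_def)
  finally have "(LINT (x :: real ^ 'd)|lborel. (\<Prod>i\<in>UNIV. f i (x $ i))) = (\<Prod>i\<in>UNIV. LINT t|lborel. f i t)"
    unfolding eq lborel_eq[where 'a = "real ^ 'd"] integral_distr[OF meas meas'] .
  with 1 show ?thesis
    by (simp add: has_bochner_integral_iff)
qed

text \<open>This is one-dimensional integration by parts, read off from the closed forms: odd
  moments vanish, and the moment of order \<open>2 * l\<close> is
  \<open>fact (2 * l) / (2 ^ l * fact l)\<close>. At \<open>k = 0\<close> the coefficient 0 hides
  the truncated exponent.\<close>

lemma std_normal_moment_Suc:
  "(LINT t|lborel. t ^ Suc k * std_normal_density t) =
     real k * (LINT t|lborel. t ^ (k - 1) * std_normal_density t)"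
proof (cases "even k")
  case True
  then obtain l where k: "k = 2 * l" by auto
  show ?thesis
  proof (cases l)
    case 0
    then show ?thesis
      using integral_std_normal_moment_odd[of 0] by (simp add: k mult.commute)
  next
    case (Suc r)
    then have "k - 1 = 2 * r + 1" "Suc k = 2 * l + 1"
      by (auto simp: k)
    then show ?thesis
      by (simp only: mult.commute[of _ "std_normal_density _"] integral_std_normal_moment_odd)
  qed
next
  case False
  then obtain l where k: "k = 2 * l + 1" by (elim oddE)
  then have "k - 1 = 2 * l" "Suc k = 2 * Suc l"
    by auto
  \<comment> \<open>Numerator and denominator both gain the factor \<open>2 * (l + 1)\<close>; after
    cancelling it, \<open>k = 2 * l + 1\<close> remains.\<close>
  moreover have "fact (2 * Suc l) / (2 ^ Suc l * fact (Suc l)) =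
      real k * (fact (2 * l) / (2 ^ l * fact l))"
  proof -
    have "(fact (2 * Suc l) :: real) = (2 * (real l + 1)) * (real k * fact (2 * l))"
      by (simp add: k algebra_simps)
    moreover have "2 ^ Suc l * (fact (Suc l) :: real) = (2 * (real l + 1)) * (2 ^ l * fact l)"
      by (simp add: algebra_simps)
    moreover have "2 * (real l + 1) \<noteq> 0"
      by simp
    ultimately show ?thesis
      by (simp only: mult_divide_mult_cancel_left times_divide_eq_right simp_thms if_False)
  qed
  ultimately show ?thesis
    by (simp only: mult.commute[of _ "std_normal_density _"] integral_std_normal_moment_even)
qed

definition std_gaussian :: "real ^ 'd \<Rightarrow> real"
  where "std_gaussian x = (\<Prod>i\<in>UNIV. std_normal_density (x $ i))"

definition gaussian_mean :: "(real ^ 'd \<Rightarrow> real) \<Rightarrow> real"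
  where "gaussian_mean f = (LINT x|lborel. f x * std_gaussian x)"

text \<open>The exponential turns the sum of squares into a product over coordinates. Being a
  product makes the Gaussian computable on monomials; being radial makes it usable as a test
  function.\<close>

lemma std_gaussian_radial:
  "std_gaussian (x :: real ^ 'd) = (1 / sqrt (2 * pi)) ^ CARD('d) * exp (- (norm x)\<^sup>2 / 2)"
proof -
  have "(norm x)\<^sup>2 = (\<Sum>i\<in>UNIV. (x $ i)\<^sup>2)"
    unfolding power2_norm_eq_inner inner_vec_def by (simp add: power2_eq_square)
  then have "exp (- (norm x)\<^sup>2 / 2) = (\<Prod>i\<in>UNIV. exp (- (x $ i)\<^sup>2 / 2))"
    by (simp add: exp_sum[symmetric] sum_negf sum_divide_distrib)
  then show ?thesis
    by (simp add: std_gaussian_def std_normal_density_def prod_dividef power_divide)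
qed

lemma has_bochner_integral_monomial_gaussian:
  "has_bochner_integral lborel (\<lambda>x. monomial a x * std_gaussian x)
     (\<Prod>i\<in>UNIV. LINT t|lborel. t ^ (a $ i) * std_normal_density t)"
  unfolding monomial_def std_gaussian_def prod.distrib[symmetric]
  by (intro has_bochner_integral_lborel_prod)
     (subst mult.commute, rule integrable_std_normal_moment)

lemma integrable_polynomial_gaussian:
  assumes "f \<in> polynomial_functions"
  shows "integrable lborel (\<lambda>x. f x * std_gaussian x)"
proof (rule span_induct[OF assms])
  show "subspace {f. integrable lborel (\<lambda>x. f x * std_gaussian x)}"
    by (rule subspaceI) (auto simp: scaleR_fun_def distrib_right mult.assoc)
next
  fix f :: "real ^ 'a \<Rightarrow> real" assume "f \<in> range monomial"
  then obtain a where f: "f = monomial a" by auto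
  show "integrable lborel (\<lambda>x. f x * std_gaussian x)"
    unfolding f using has_bochner_integral_monomial_gaussian by (rule integrable.intros)
qed

lemma gaussian_mean_add:
  assumes "f \<in> polynomial_functions" "g \<in> polynomial_functions"
  shows "gaussian_mean (\<lambda>x. f x + g x) = gaussian_mean f + gaussian_mean g"
  using assms[THEN integrable_polynomial_gaussian]
  by (simp add: gaussian_mean_def distrib_right)

lemma gaussian_mean_mult_left: "gaussian_mean (\<lambda>x. c * f x) = c * gaussian_mean f"
  by (simp add: gaussian_mean_def mult.assoc)

lemma gaussian_mean_sum:
  assumes "\<And>i. i \<in> I \<Longrightarrow> f i \<in> polynomial_functions"
  shows "gaussian_mean (\<lambda>x. \<Sum>i\<in>I. f i x) = (\<Sum>i\<in>I. gaussian_mean (f i))"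
  using assms[THEN integrable_polynomial_gaussian]
  by (simp add: gaussian_mean_def sum_distrib_right)

text \<open>The mean of a monomial is a product of one-dimensional moments. Only the factor with
  index \<open>i\<close> changes, and there \<open>std_normal_moment_Suc\<close> applies.\<close>

lemma gaussian_mean_monomial_parts:
  "gaussian_mean (\<lambda>x. x $ i * monomial a x) = real (a $ i) * gaussian_mean (monomial (a - axis i 1))"
proof -
  define m where "m k = (LINT t|lborel. t ^ k * std_normal_density t)" for k
  have mean: "gaussian_mean (monomial b) = (\<Prod>l\<in>UNIV. m (b $ l))" for b :: "nat ^ 'a"
    unfolding gaussian_mean_def m_def
    by (rule has_bochner_integral_integral_eq[OF has_bochner_integral_monomial_gaussian])
  have 1: "(\<lambda>x. x $ i * monomial a x) = monomial (axis i 1 + a)"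
    by (simp add: fun_eq_iff monomial_mult[symmetric] monomial_axis del: One_nat_def)
  have rest: "(\<Prod>l\<in>UNIV - {i}. m ((axis i 1 + a) $ l)) = (\<Prod>l\<in>UNIV - {i}. m (a $ l))"
    "(\<Prod>l\<in>UNIV - {i}. m ((a - axis i 1) $ l)) = (\<Prod>l\<in>UNIV - {i}. m (a $ l))"
    by (auto intro!: prod.cong simp: axis_def)
  have "m ((axis i 1 + a) $ i) = real (a $ i) * m ((a - axis i 1) $ i)"
    using std_normal_moment_Suc[of "a $ i"] by (simp add: m_def axis_def)
  then show ?thesis
    unfolding 1 mean prod.remove[OF finite_class.finite_UNIV UNIV_I, of _ i] rest by simp
qed

lemma gaussian_integration_by_parts:
  assumes f: "f \<in> polynomial_functions"
  shows "gaussian_mean (\<lambda>x. x $ i * f x) = gaussian_mean (partial_deriv i f)"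
proof -
  \<comment> \<open>The identity is bundled with polynomiality, which gives the integrability behind
    additivity of the mean, and with \<open>has_partial\<close>, which later identifies
    \<open>g\<close>.\<close>
  define P where "P f g \<longleftrightarrow> f \<in> polynomial_functions \<and> g \<in> polynomial_functions \<and> has_partial i f g \<and>
    gaussian_mean (\<lambda>x. x $ i * f x) = gaussian_mean g" for f g :: "real ^ 'a \<Rightarrow> real"
  have "\<exists>g. P f g"
  proof (rule span_induct[OF f])
    show "subspace {f. \<exists>g. P f g}"
    proof (intro subspaceI CollectI; (elim CollectE exE)?)
      show "\<exists>g. P 0 g"
        by (rule exI[of _ 0]) (simp add: P_def span_zero has_partial_zero gaussian_mean_def)
    next
      fix u v gu gv assume P: "P u gu" "P v gv"
      have "gaussian_mean (\<lambda>x. x $ i * (u + v) x) = gaussian_mean (gu + gv)"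
        using P by (simp add: P_def distrib_left gaussian_mean_add polynomial_mult
            polynomial_component plus_fun_def)
      with P show "\<exists>g. P (u + v) g"
        by (intro exI[of _ "gu + gv"]) (simp add: P_def span_add has_partial_add)
    next
      fix c u gu assume P: "P u gu"
      have "gaussian_mean (\<lambda>x. x $ i * (c *\<^sub>R u) x) = gaussian_mean (c *\<^sub>R gu)"
        using P by (simp add: P_def scaleR_fun_def gaussian_mean_mult_left mult.left_commute[of _ c])
      with P show "\<exists>g. P (c *\<^sub>R u) g"
        by (intro exI[of _ "c *\<^sub>R gu"]) (simp add: P_def span_scale has_partial_scaleR)
    qed
  next
    fix f :: "real ^ 'a \<Rightarrow> real" assume "f \<in> range monomial"
    then obtain a where f: "f = monomial a" by auto
    have "gaussian_mean (\<lambda>x. x $ i * f x) = gaussian_mean (real (a $ i) *\<^sub>R monomial (a - axis i 1))"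
      unfolding f gaussian_mean_monomial_parts scaleR_fun_def real_scaleR_def
        gaussian_mean_mult_left ..
    moreover have "has_partial i f (real (a $ i) *\<^sub>R monomial (a - axis i 1))"
      unfolding f by (rule has_partial_monomial)
    moreover have "f \<in> polynomial_functions" "real (a $ i) *\<^sub>R monomial (a - axis i 1) \<in> polynomial_functions"
      by (auto simp: f intro: span_base span_scale)
    ultimately show "\<exists>g. P f g"
      unfolding P_def by blast
  qed
  then obtain g where "P f g"
    by blast
  then have "has_partial i f g" "gaussian_mean (\<lambda>x. x $ i * f x) = gaussian_mean g"
    by (auto simp: P_def)
  with has_partial_imp_partial_deriv[OF this(1)] show ?thesis
    by simp
qed

section \<open>Green's identity and Gaussian orthogonality of harmonic polynomials\<close>

lemma laplacian_homogeneous: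
  assumes "f \<in> homogeneous_polynomials M"
  shows "laplacian f \<in> homogeneous_polynomials (M - 2)"
proof -
  have "laplacian f = (\<Sum>i\<in>UNIV. partial_deriv i (partial_deriv i f))"
    unfolding laplacian_def[abs_def] by (rule ext) (rule sum_fun_apply[symmetric])
  moreover have "partial_deriv i (partial_deriv i f) \<in> homogeneous_polynomials (M - 2)" for i
    using partial_deriv_homogeneous[OF partial_deriv_homogeneous[OF assms, of i], of i]
    by (simp add: numeral_2_eq_2)
  ultimately show ?thesis
    unfolding homogeneous_polynomials_def by (simp add: span_sum)
qed

text \<open>Complements \<open>partial_deriv_homogeneous\<close>, whose truncated degree yields only
  a constant when the degree is 0.\<close>

lemma partial_deriv_homogeneous_0:
  assumes "f \<in> homogeneous_polynomials 0"
  shows "partial_deriv i f = 0"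
proof -
  have "partial_deriv i f \<in> {0}"
  proof (rule partial_deriv_span(2)[OF assms[unfolded homogeneous_polynomials_def]], safe)
    fix a :: "nat ^ 'a" assume "\<bar>a\<bar>\<^sub>v = 0"
    then show "partial_deriv i (monomial a) = 0"
      by (simp add: partial_deriv_monomial vec_size_def)
    show "has_partial i (monomial a) (partial_deriv i (monomial a))"
      unfolding partial_deriv_monomial by (rule has_partial_monomial)
  qed (rule subspace_single_0)
  then show ?thesis by simp
qed

text \<open>Euler's identity writes \<open>M * f\<close> as the sum of
  \<open>x $ i * partial_deriv i f\<close>; integration by parts moves each \<open>x $ i\<close>
  into a derivative of \<open>partial_deriv i f * g\<close>, and the product rule gives the two
  terms. The gradient term is symmetric in \<open>f\<close> and \<open>g\<close>.\<close>

lemma gaussian_green: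
  assumes f: "f \<in> homogeneous_polynomials M" and g: "g \<in> polynomial_functions"
  shows "real M * gaussian_mean (\<lambda>x. f x * g x) =
    gaussian_mean (\<lambda>x. laplacian f x * g x) +
    (\<Sum>i\<in>UNIV. gaussian_mean (\<lambda>x. partial_deriv i f x * partial_deriv i g x))"
proof -
  note fP = homogeneous_imp_polynomial[OF f]
  have [simp]: "partial_deriv i f \<in> polynomial_functions"
    "partial_deriv i (partial_deriv i f) \<in> polynomial_functions"
    "partial_deriv i g \<in> polynomial_functions" for i
    by (auto intro: partial_deriv_polynomial fP g)
  have parts: "gaussian_mean (\<lambda>x. x $ i * (partial_deriv i f x * g x)) =
    gaussian_mean (\<lambda>x. partial_deriv i (partial_deriv i f) x * g x) +
    gaussian_mean (\<lambda>x. partial_deriv i f x * partial_deriv i g x)" for i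
  proof -
    have "has_partial i (\<lambda>x. partial_deriv i f x * g x)
       (\<lambda>x. partial_deriv i (partial_deriv i f) x * g x + partial_deriv i f x * partial_deriv i g x)"
      by (intro has_partial_mult has_partial_polynomial) (simp_all add: g)
    from has_partial_imp_partial_deriv[OF this] show ?thesis
      by (simp add: gaussian_integration_by_parts gaussian_mean_add polynomial_mult g)
  qed
  have "real M * gaussian_mean (\<lambda>x. f x * g x) =
      gaussian_mean (\<lambda>x. \<Sum>i\<in>UNIV. x $ i * (partial_deriv i f x * g x))"
    unfolding gaussian_mean_mult_left[symmetric] mult.assoc[symmetric]
    by (simp add: euler_homogeneous[OF f, symmetric] sum_distrib_right)
  also have "\<dots> = (\<Sum>i\<in>UNIV. gaussian_mean (\<lambda>x. x $ i * (partial_deriv i f x * g x)))"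
    by (intro gaussian_mean_sum polynomial_mult) (simp_all add: g polynomial_component)
  also have "\<dots> = gaussian_mean (\<lambda>x. \<Sum>i\<in>UNIV. partial_deriv i (partial_deriv i f) x * g x) +
    (\<Sum>i\<in>UNIV. gaussian_mean (\<lambda>x. partial_deriv i f x * partial_deriv i g x))"
    by (subst gaussian_mean_sum) (simp_all add: parts sum.distrib polynomial_mult g)
  finally show ?thesis
    by (simp add: laplacian_def sum_distrib_right)
qed

text \<open>Green's identity is used for \<open>(Y, Q)\<close> and for \<open>(Q, Y)\<close>. The
  gradient terms agree, the Laplacian of \<open>Y\<close> is 0, and that of \<open>Q\<close> has
  lower degree and is handled by induction. Hence \<open>k\<close> and \<open>m\<close> times the
  same mean are equal, while \<open>k < m\<close>.\<close>

lemma harmonic_gaussian_orthogonal: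
  assumes Y: "Y \<in> harmonic_polynomials m"
  shows "Q \<in> homogeneous_polynomials k \<Longrightarrow> k < m \<Longrightarrow> gaussian_mean (\<lambda>x. Y x * Q x) = 0"
proof (induction k arbitrary: Q rule: less_induct)
  case (less k)
  have YH: "Y \<in> homogeneous_polynomials m" and Y0: "laplacian Y x = 0" for x
    using Y by (auto simp: harmonic_polynomials_def)
  have "gaussian_mean (\<lambda>x. laplacian Q x * Y x) = 0"
  \<comment> \<open>The induction hypothesis needs \<open>k - 2 < k\<close>, which fails under
    truncation exactly at \<open>k = 0\<close>; there \<open>Q\<close> is constant and its Laplacian
    is 0.\<close>
  proof (cases "k = 0")
    case True
    have "partial_deriv i Q = 0" "partial_deriv i (0 :: real ^ 'a \<Rightarrow> real) = 0" for i
      using less.prems True partial_deriv_homogeneous_0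
        has_partial_imp_partial_deriv[OF has_partial_zero] by auto
    then show ?thesis
      by (simp add: laplacian_def gaussian_mean_def)
  next
    case False
    then show ?thesis
      using less.IH[of "k - 2" "laplacian Q"] laplacian_homogeneous[OF less.prems(1)] less.prems(2)
      by (simp add: mult.commute)
  qed
  then have "real k * gaussian_mean (\<lambda>x. Y x * Q x) = real m * gaussian_mean (\<lambda>x. Y x * Q x)"
    using gaussian_green[OF YH homogeneous_imp_polynomial[OF less.prems(1)]]
      gaussian_green[OF less.prems(1) homogeneous_imp_polynomial[OF YH]]
    by (simp add: Y0 mult.commute gaussian_mean_def)
  then show ?case
    using less.prems(2) by auto
qed

section \<open>Integrals of radial functions times homogeneous functions\<close>

lemma nn_integral_lborel_scaleR:
  fixes g :: "'a::euclidean_space \<Rightarrow> ennreal"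
  assumes [measurable]: "g \<in> borel_measurable borel" and c: "c > 0"
  shows "(\<integral>\<^sup>+x. g x \<partial>lborel) = ennreal (c ^ DIM('a)) * (\<integral>\<^sup>+x. g (c *\<^sub>R x) \<partial>lborel)"
proof -
  have "(\<integral>\<^sup>+x. g x \<partial>lborel) =
      (\<integral>\<^sup>+x. g x \<partial>density (distr lborel borel (\<lambda>x. 0 + c *\<^sub>R x)) (\<lambda>_. ennreal (\<bar>c\<bar> ^ DIM('a))))"
    using c by (subst lborel_affine[of c 0]) simp_all
  also have "\<dots> = (\<integral>\<^sup>+x. ennreal (c ^ DIM('a)) * g (c *\<^sub>R x) \<partial>lborel)"
    using c by (simp add: nn_integral_density nn_integral_distr)
  also have "\<dots> = ennreal (c ^ DIM('a)) * (\<integral>\<^sup>+x. g (c *\<^sub>R x) \<partial>lborel)"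
    by (rule nn_integral_cmult) measurable
  finally show ?thesis .
qed

text \<open>
  Scaling determines the measure of every ball up to a constant, and the balls determine the
  image measure under the norm. This replaces polar coordinates.
\<close>

lemma distr_norm_homogeneous_density:
  fixes f :: "'a::euclidean_space \<Rightarrow> real"
  assumes f [measurable]: "f \<in> borel_measurable borel" and nonneg: "\<And>x. f x \<ge> 0"
    and hom: "\<And>c x. c > 0 \<Longrightarrow> f (c *\<^sub>R x) = c ^ M * f x"
    and fin: "(\<integral>\<^sup>+x. ennreal (f x) * indicator (cball 0 1) x \<partial>lborel) < \<infinity>"
  obtains C where "C \<ge> 0" "distr (density lborel f) borel norm =
    density lborel (\<lambda>\<rho>. ennreal (indicator {0..} \<rho> * (C * \<rho> ^ (M + DIM('a) - 1))))"
proof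
  \<comment> \<open>The mass of a ball of radius \<open>r\<close> scales as \<open>r ^ N\<close>:
    \<open>M\<close> factors come from homogeneity of \<open>f\<close>, \<open>DIM('a)\<close> from
    Lebesgue measure.\<close>
  define N where "N = M + DIM('a)"
  have N: "N > 0"
    by (simp add: N_def)
  define E where "E = enn2real (\<integral>\<^sup>+x. ennreal (f x) * indicator (cball 0 1) x \<partial>lborel)"
  have E: "ennreal E = (\<integral>\<^sup>+x. ennreal (f x) * indicator (cball 0 1) x \<partial>lborel)" "E \<ge> 0"
    using fin by (simp_all add: E_def)
  \<comment> \<open>Chosen so that \<open>C * \<rho> ^ (N - 1)\<close> is the derivative of
    \<open>E * \<rho> ^ N\<close>.\<close>
  define C where "C = real N * E"
  show C: "C \<ge> 0"
    using E by (simp add: C_def)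
  let ?L = "distr (density lborel f) borel norm"
  let ?R = "density lborel (\<lambda>\<rho>. ennreal (indicator {0..} \<rho> * (C * \<rho> ^ (M + DIM('a) - 1))))"
  have L: "emeasure ?L {..r} = (\<integral>\<^sup>+x. ennreal (f x) * indicator (cball 0 r) x \<partial>lborel)" for r
  proof -
    have "norm -` {..r} = cball (0 :: 'a) r"
      by (auto simp: cball_def)
    then show ?thesis
      by (simp add: emeasure_distr emeasure_density)
  qed
  have L': "emeasure ?L {..r} = (if r < 0 then 0 else ennreal (E * r ^ N))" for r
  proof -
    consider "r < 0" | "r = 0" | "r > 0" by linarith
    then show ?thesis
    proof cases
      case 1
      then show ?thesis by (simp add: L)
    next
      case 2
      \<comment> \<open>Scaling is available only for positive factors; the ball of radius 0 is a
        null set instead.\<close>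
      have "(\<integral>\<^sup>+x. ennreal (f x) * indicator (cball 0 0) x \<partial>lborel) = (\<integral>\<^sup>+x. 0 \<partial>lborel :: 'a measure)"
        by (rule nn_integral_cong_AE)
           (use AE_lborel_singleton[of "0 :: 'a"] in eventually_elim, simp)
      then show ?thesis
        using N by (simp add: L 2 zero_power)
    next
      case 3
      have "emeasure ?L {..r} = ennreal (r ^ DIM('a)) *
          (\<integral>\<^sup>+x. ennreal (f (r *\<^sub>R x)) * indicator (cball 0 r) (r *\<^sub>R x) \<partial>lborel)"
        unfolding L by (intro nn_integral_lborel_scaleR[OF _ 3] borel_measurable_times_ennreal
            borel_measurable_indicator) simp_all
      also have "(\<integral>\<^sup>+x. ennreal (f (r *\<^sub>R x)) * indicator (cball 0 r) (r *\<^sub>R x) \<partial>lborel) =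
          (\<integral>\<^sup>+x. ennreal (r ^ M) * (ennreal (f x) * indicator (cball 0 1) x) \<partial>lborel)"
        using 3 by (intro nn_integral_cong)
          (auto simp: hom nonneg ennreal_mult indicator_def mult_le_cancel_left1)
      also have "\<dots> = ennreal (r ^ M) * ennreal E"
        unfolding E by (intro nn_integral_cmult borel_measurable_times_ennreal
            borel_measurable_indicator) simp_all
      also have "ennreal (r ^ DIM('a)) * (ennreal (r ^ M) * ennreal E) = ennreal (E * r ^ N)"
        using 3 E(2) by (simp add: ennreal_mult[symmetric] N_def power_add mult_ac)
      finally show ?thesis
        using 3 by simp
    qed
  qed
  have R': "emeasure ?R {..r} = (if r < 0 then 0 else ennreal (E * r ^ N))" for r
  proof -
    have "emeasure ?R {..r} = (\<integral>\<^sup>+\<rho>. ennreal (C * \<rho> ^ (N - 1)) * indicator {0..r} \<rho> \<partial>lborel)"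
      by (subst emeasure_density) (auto simp: N_def intro!: nn_integral_cong split: split_indicator)
    also have "\<dots> = (if r < 0 then 0 else ennreal (E * r ^ N))"
    proof (cases "r < 0")
      case False
      have "(\<integral>\<^sup>+\<rho>. ennreal (C * \<rho> ^ (N - 1)) * indicator {0..r} \<rho> \<partial>lborel) =
          ennreal (E * r ^ N - E * 0 ^ N)"
        using False C by (intro nn_integral_FTC_Icc)
          (auto intro!: derivative_eq_intros simp: C_def)
      then show ?thesis
        using False N by (simp add: zero_power)
    qed simp
    finally show ?thesis .
  qed
  show "?L = ?R"
  proof (rule measure_eqI_generator_eq[where \<Omega> = UNIV and E = "range atMost" and A = "\<lambda>i. {..real i}"])
    show "Int_stable (range atMost :: real set set)"
      by (auto simp: Int_stable_def)
    show "sets ?L = sigma_sets UNIV (range atMost)" "sets ?R = sigma_sets UNIV (range atMost)"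
      by (simp_all add: borel_eq_atMost)
    show "(\<Union>i. {..real i}) = UNIV"
      by (auto intro: real_arch_simple)
    show "emeasure ?L X = emeasure ?R X" if "X \<in> range atMost" for X
      using that L' R' by auto
    show "emeasure ?L {..real i} \<noteq> \<infinity>" for i
      by (simp add: L')
  qed auto
qed

lemma radial_integral_nonneg:
  fixes f :: "'a::euclidean_space \<Rightarrow> real"
  assumes f [measurable]: "f \<in> borel_measurable borel" and nonneg: "\<And>x. f x \<ge> 0"
    and hom: "\<And>c x. c > 0 \<Longrightarrow> f (c *\<^sub>R x) = c ^ M * f x"
    and fin: "(\<integral>\<^sup>+x. ennreal (f x) * indicator (cball 0 1) x \<partial>lborel) < \<infinity>"
  obtains C where "\<And>\<phi> :: real \<Rightarrow> real. \<phi> \<in> borel_measurable borel \<Longrightarrow>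
    (LINT x|lborel. \<phi> (norm x) * f x) = C * (LINT \<rho>:{0..}|lborel. \<phi> \<rho> * \<rho> ^ (M + DIM('a) - 1))"
proof -
  obtain C where C: "C \<ge> 0" and eq: "distr (density lborel f) borel norm =
      density lborel (\<lambda>\<rho>. ennreal (indicator {0..} \<rho> * (C * \<rho> ^ (M + DIM('a) - 1))))"
    using distr_norm_homogeneous_density[OF assms] by blast
  show ?thesis
  proof (rule that[of C])
    fix \<phi> :: "real \<Rightarrow> real" assume [measurable]: "\<phi> \<in> borel_measurable borel"
    have "(LINT x|lborel. \<phi> (norm x) * f x) = (LINT x|density lborel f. \<phi> (norm x))"
      by (subst integral_density) (simp_all add: nonneg mult.commute)
    also have "\<dots> = (LINT \<rho>|distr (density lborel f) borel norm. \<phi> \<rho>)"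
      by (subst integral_distr) simp_all
    also have "\<dots> = (LINT \<rho>|lborel. C * (indicator {0..} \<rho> *\<^sub>R (\<phi> \<rho> * \<rho> ^ (M + DIM('a) - 1))))"
      unfolding eq using C
      by (subst integral_density) (auto simp: mult_ac split: split_indicator)
    finally show "(LINT x|lborel. \<phi> (norm x) * f x) =
        C * (LINT \<rho>:{0..}|lborel. \<phi> \<rho> * \<rho> ^ (M + DIM('a) - 1))"
      by (simp add: set_lebesgue_integral_def)
  qed
qed

text \<open>The positive and negative parts of \<open>P\<close> are nonnegative and, for positive
  scaling factors, again homogeneous; \<open>C\<close> is the difference of their constants. It is
  fixed before \<open>\<phi>\<close>, so a single test function can determine it.\<close>

lemma radial_integral:
  fixes P :: "'a::euclidean_space \<Rightarrow> real"
  assumes cont: "continuous_on UNIV P" and hom: "\<And>c x. c > 0 \<Longrightarrow> P (c *\<^sub>R x) = c ^ M * P x"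
  obtains C where "\<And>\<phi> :: real \<Rightarrow> real. \<phi> \<in> borel_measurable borel \<Longrightarrow>
    integrable lborel (\<lambda>x. \<phi> (norm x) * P x) \<Longrightarrow>
    (LINT x|lborel. \<phi> (norm x) * P x) = C * (LINT \<rho>:{0..}|lborel. \<phi> \<rho> * \<rho> ^ (M + DIM('a) - 1))"
proof -
  have nonneg_case: "\<exists>C. \<forall>\<phi> :: real \<Rightarrow> real. \<phi> \<in> borel_measurable borel \<longrightarrow>
    (LINT x|lborel. \<phi> (norm x) * max 0 (s * P x)) =
      C * (LINT \<rho>:{0..}|lborel. \<phi> \<rho> * \<rho> ^ (M + DIM('a) - 1))" for s
  proof -
    let ?f = "\<lambda>x. max 0 (s * P x)"
    have cont': "continuous_on S ?f" for S
      by (intro continuous_intros continuous_on_subset[OF cont]) auto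
    have 1: "?f \<in> borel_measurable borel"
      by (rule borel_measurable_continuous_onI) (rule cont')
    have 2: "?f (c *\<^sub>R x) = c ^ M * ?f x" if "c > 0" for c x
      using that by (simp add: hom max_mult_distrib_left mult.left_commute)
    have "integrable lborel (\<lambda>x. indicator (cball 0 1) x *\<^sub>R ?f x)"
      by (intro borel_integrable_compact cont') auto
    then have "(\<integral>\<^sup>+x. ennreal (norm (indicator (cball 0 1) x *\<^sub>R ?f x)) \<partial>lborel) < \<infinity>"
      by (simp only: integrable_iff_bounded)
    also have "(\<integral>\<^sup>+x. ennreal (norm (indicator (cball 0 1) x *\<^sub>R ?f x)) \<partial>lborel) =
        (\<integral>\<^sup>+x. ennreal (?f x) * indicator (cball 0 1) x \<partial>lborel)"
      by (intro nn_integral_cong) (auto split: split_indicator)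
    finally have 3: "(\<integral>\<^sup>+x. ennreal (?f x) * indicator (cball 0 1) x \<partial>lborel) < \<infinity>" .
    have 4: "?f x \<ge> 0" for x
      by simp
    show ?thesis
      by (rule radial_integral_nonneg[OF 1 4 2 3]) blast+
  qed
  obtain C1 where C1: "\<And>\<phi> :: real \<Rightarrow> real. \<phi> \<in> borel_measurable borel \<Longrightarrow>
    (LINT x|lborel. \<phi> (norm x) * max 0 (1 * P x)) =
      C1 * (LINT \<rho>:{0..}|lborel. \<phi> \<rho> * \<rho> ^ (M + DIM('a) - 1))"
    using nonneg_case[of 1] by blast
  obtain C2 where C2: "\<And>\<phi> :: real \<Rightarrow> real. \<phi> \<in> borel_measurable borel \<Longrightarrow>
    (LINT x|lborel. \<phi> (norm x) * max 0 (-1 * P x)) =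
      C2 * (LINT \<rho>:{0..}|lborel. \<phi> \<rho> * \<rho> ^ (M + DIM('a) - 1))"
    using nonneg_case[of "-1"] by blast
  have [measurable]: "P \<in> borel_measurable borel"
    by (rule borel_measurable_continuous_onI) (rule cont)
  show ?thesis
  proof (rule that[of "C1 - C2"])
    fix \<phi> :: "real \<Rightarrow> real"
    assume \<phi> [measurable]: "\<phi> \<in> borel_measurable borel"
      and int: "integrable lborel (\<lambda>x. \<phi> (norm x) * P x)"
    \<comment> \<open>Each part is dominated by \<open>P\<close>, so the integral of the difference
      may be split.\<close>
    have int': "integrable lborel (\<lambda>x. \<phi> (norm x) * max 0 (s * P x))" if "\<bar>s\<bar> = 1" for s
    proof (rule Bochner_Integration.integrable_bound[OF int])
      have "\<bar>max 0 (s * P x)\<bar> \<le> \<bar>P x\<bar>" for x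
        using that abs_mult[of s "P x"] by (auto simp: max_def)
      then show "AE x in lborel. norm (\<phi> (norm x) * max 0 (s * P x)) \<le> norm (\<phi> (norm x) * P x)"
        by (auto simp: abs_mult intro!: mult_left_mono)
    qed measurable
    have "\<phi> (norm x) * P x = \<phi> (norm x) * max 0 (1 * P x) - \<phi> (norm x) * max 0 (-1 * P x)" for x
      by (auto simp: max_def)
    then have "(LINT x|lborel. \<phi> (norm x) * P x) =
        (LINT x|lborel. \<phi> (norm x) * max 0 (1 * P x)) - (LINT x|lborel. \<phi> (norm x) * max 0 (-1 * P x))"
      using Bochner_Integration.integral_diff[OF int'[of 1] int'[of "-1"]] by simp
    then show "(LINT x|lborel. \<phi> (norm x) * P x) =
        (C1 - C2) * (LINT \<rho>:{0..}|lborel. \<phi> \<rho> * \<rho> ^ (M + DIM('a) - 1))"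
      unfolding C1[OF \<phi>] C2[OF \<phi>] by (simp add: left_diff_distrib)
  qed
qed

text \<open>The integrand is nonnegative and strictly positive on the interval from 0 to 1, which is
  not a null set. This allows the radial factor to be cancelled when the Gaussian is the test
  function.\<close>

lemma radial_gaussian_moment_nonzero:
  "(LINT \<rho>:{0..}|lborel. std_normal_density \<rho> * \<rho> ^ k) \<noteq> 0"
proof
  assume 0: "(LINT \<rho>:{0..}|lborel. std_normal_density \<rho> * \<rho> ^ k) = 0"
  have "integrable lborel (\<lambda>\<rho>. indicator {0..} \<rho> *\<^sub>R (std_normal_density \<rho> * \<rho> ^ k))"
    by (intro integrable_mult_indicator integrable_std_normal_moment) simp
  then have "AE \<rho> in lborel. indicator {0..} \<rho> *\<^sub>R (std_normal_density \<rho> * \<rho> ^ k) = 0"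
    using 0 unfolding set_lebesgue_integral_def
    by (subst (asm) integral_nonneg_eq_0_iff_AE) (auto split: split_indicator)
  then have "AE \<rho> in lborel. \<rho> \<notin> {0<..<1::real}"
  proof eventually_elim
    case (elim \<rho>)
    then show ?case
      using normal_density_pos[of 1 0 \<rho>] by (auto split: split_indicator)
  qed
  then have "emeasure lborel {0<..<1::real} = 0"
    by (subst (asm) AE_iff_measurable[where N = "{0<..<1}"]) auto
  then show False
    by simp
qed

lemma harmonic_radial_integral:
  fixes Y :: "real ^ 'd \<Rightarrow> real"
  assumes Y: "Y \<in> harmonic_polynomials m" and Q: "Q \<in> homogeneous_polynomials k"
  obtains C where "\<And>\<phi> :: real \<Rightarrow> real. \<phi> \<in> borel_measurable borel \<Longrightarrow>
    integrable lborel (\<lambda>x. \<phi> (norm x) * (Y x * Q x)) \<Longrightarrow>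
    (LINT x|lborel. \<phi> (norm x) * (Y x * Q x)) =
      C * (LINT \<rho>:{0..}|lborel. \<phi> \<rho> * \<rho> ^ (m + k + CARD('d) - 1))"
    and "k < m \<Longrightarrow> C = 0"
proof -
  have YH: "Y \<in> homogeneous_polynomials m"
    using Y by (simp add: harmonic_polynomials_def)
  note P = homogeneous_mult[OF YH Q]
  obtain C where C: "\<And>\<phi> :: real \<Rightarrow> real. \<phi> \<in> borel_measurable borel \<Longrightarrow>
    integrable lborel (\<lambda>x. \<phi> (norm x) * (Y x * Q x)) \<Longrightarrow>
    (LINT x|lborel. \<phi> (norm x) * (Y x * Q x)) =
      C * (LINT \<rho>:{0..}|lborel. \<phi> \<rho> * \<rho> ^ (m + k + DIM(real ^ 'd) - 1))"
    by (rule radial_integral[of "\<lambda>x. Y x * Q x" "m + k"])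
       (auto intro: polynomial_continuous_on[OF homogeneous_imp_polynomial[OF P]] homogeneous_scaleR[OF P])
  show ?thesis
  proof (rule that[of C])
    assume "k < m"
    \<comment> \<open>The quotient of the normalising constants in dimension \<open>CARD('d)\<close>
      and dimension 1, so that \<open>\<phi> (norm x)\<close> is exactly the Gaussian on
      \<open>real ^ 'd\<close>.\<close>
    define c where "c = (1 / sqrt (2 * pi)) ^ CARD('d) / (1 / sqrt (2 * pi))"
    have c: "c \<noteq> 0"
      by (simp add: c_def)
    define \<phi> where "\<phi> \<rho> = c * std_normal_density \<rho>" for \<rho>
    have \<phi>: "\<phi> (norm x) = std_gaussian x" for x :: "real ^ 'd"
      unfolding \<phi>_def std_gaussian_radial std_normal_density_def c_def by simp
    have "\<phi> \<in> borel_measurable borel"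
      unfolding \<phi>_def[abs_def] by measurable
    moreover have "integrable lborel (\<lambda>x. \<phi> (norm x) * (Y x * Q x))"
      using integrable_polynomial_gaussian[OF homogeneous_imp_polynomial[OF P]]
      by (simp add: \<phi> mult.commute)
    moreover have "(LINT x|lborel. \<phi> (norm x) * (Y x * Q x)) = 0"
      using harmonic_gaussian_orthogonal[OF Y Q \<open>k < m\<close>]
      by (simp add: \<phi> gaussian_mean_def mult.commute)
    ultimately have "0 = C * (LINT \<rho>:{0..}|lborel. \<phi> \<rho> * \<rho> ^ (m + k + DIM(real ^ 'd) - 1))"
      using C[of \<phi>] by (simp only:)
    then show "C = 0"
      using c radial_gaussian_moment_nonzero by (simp add: \<phi>_def mult.assoc)
  qed (use C in simp)
qed

section \<open>Integrability and measurability for radial weights\<close>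

lemma weight_integrable_polynomial:
  assumes W: "weight_function W" and f: "f \<in> polynomial_functions"
  shows "integrable lborel (\<lambda>x. f x * W x)"
proof (rule span_induct[OF f])
  show "subspace {f. integrable lborel (\<lambda>x. f x * W x)}"
    by (rule subspaceI) (auto simp: scaleR_fun_def distrib_right mult.assoc)
qed (use W in \<open>auto simp: weight_function_def\<close>)

lemma weight_function_measurable:
  assumes "weight_function W"
  shows "W \<in> borel_measurable borel"
proof -
  have "integrable lborel (\<lambda>x. monomial 0 x * W x)"
    using assms by (simp add: weight_function_def)
  then show ?thesis
    by (simp add: monomial_def)
qed

text \<open>An odd power of the norm need not be polynomial, but \<open>norm x ^ (2 * k)\<close> is.
  With \<open>s = norm x ^ k\<close>, the bound \<open>s \<le> 1 + s ^ 2\<close> gives an integrable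
  majorant.\<close>

lemma weight_integrable_norm_power:
  fixes W :: "real ^ 'd \<Rightarrow> real"
  assumes W: "weight_function W" and f: "f \<in> polynomial_functions"
  shows "integrable lborel (\<lambda>x. norm x ^ k * (f x * W x))"
proof -
  have [measurable]: "W \<in> borel_measurable borel" "f \<in> borel_measurable borel"
    using W f weight_function_measurable polynomial_continuous_on borel_measurable_continuous_onI by blast+
  have "(\<lambda>x :: real ^ 'd. (norm x) ^ (2 * k)) = (\<lambda>x. (\<Sum>i\<in>UNIV. x $ i * x $ i) ^ k)"
    by (simp add: power_mult power2_norm_eq_inner inner_vec_def)
  then have "(\<lambda>x :: real ^ 'd. (norm x) ^ (2 * k)) \<in> polynomial_functions"
    by (simp only:) (intro polynomial_power polynomial_sum polynomial_mult polynomial_component)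
  from polynomial_mult[OF this f]
  have "integrable lborel (\<lambda>x. norm x ^ (2 * k) * f x * W x)"
    by (rule weight_integrable_polynomial[OF W])
  then have int: "integrable lborel (\<lambda>x. norm (f x * W x) + norm (norm x ^ (2 * k) * f x * W x))"
    using weight_integrable_polynomial[OF W f] by (intro Bochner_Integration.integrable_add integrable_norm)
  show ?thesis
  proof (rule Bochner_Integration.integrable_bound[OF int])
    have "norm (norm x ^ k * (f x * W x)) \<le> norm (norm (f x * W x) + norm (norm x ^ (2 * k) * f x * W x))" for x
    proof -
      have "norm x ^ k \<le> 1 + norm x ^ (2 * k)"
        using zero_le_square[of "norm x ^ k - 1"] zero_le_power[of "norm x" k]
        unfolding mult_2 power_add by (simp add: algebra_simps) (smt (verit) norm_ge_zero zero_le_power)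
      then have "norm x ^ k * \<bar>f x * W x\<bar> \<le> (1 + norm x ^ (2 * k)) * \<bar>f x * W x\<bar>"
        by (rule mult_right_mono) simp
      then show ?thesis
        by (simp add: abs_mult algebra_simps)
    qed
    then show "AE x in lborel. norm (norm x ^ k * (f x * W x)) \<le>
        norm (norm (f x * W x) + norm (norm x ^ (2 * k) * f x * W x))"
      by simp
  qed measurable
qed

lemma weight_integrable_poly_norm:
  assumes "weight_function W" "f \<in> polynomial_functions"
  shows "integrable lborel (\<lambda>x. poly p (norm x) * (f x * W x))"
  unfolding poly_altdef sum_distrib_right mult.assoc
  by (intro Bochner_Integration.integrable_sum integrable_mult_right weight_integrable_norm_power assms)

text \<open>\<open>W\<close> determines \<open>\<omega>\<close> only on nonnegative arguments, hence
  the even extension. It is the restriction of \<open>W\<close> to a coordinate axis, with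
  \<open>undefined\<close> naming an arbitrary coordinate.\<close>

lemma radial_weight_profile_measurable:
  assumes "radial_weight (W :: real ^ 'd \<Rightarrow> real) \<omega>"
  shows "(\<lambda>\<rho>. \<omega> \<bar>\<rho>\<bar>) \<in> borel_measurable borel"
proof -
  have [measurable]: "W \<in> borel_measurable borel"
    using assms weight_function_measurable by (auto simp: radial_weight_def)
  have "(\<lambda>\<rho>. \<omega> \<bar>\<rho>\<bar>) = (\<lambda>\<rho>. W (\<rho> *\<^sub>R axis undefined 1))"
    using assms by (simp add: radial_weight_def fun_eq_iff norm_axis_1)
  then show ?thesis
    by simp
qed

section \<open>Reduction of the planar integral to the Type I relation\<close>

theorem proposition24:
  fixes W :: "'r::finite \<Rightarrow> real ^ 2 \<Rightarrow> real"
    and \<omega> :: "'r \<Rightarrow> real \<Rightarrow> real"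
    and n j :: "nat ^ 'r"
    and q :: "'r \<Rightarrow> real poly"
    and Y :: "nat \<Rightarrow> real ^ 2 \<Rightarrow> real"
    and \<nu> :: nat
    and a :: "nat ^ 2"
  assumes "\<And>l. radial_weight (W l) (\<omega> l)"
    and "real \<bar>j\<bar>\<^sub>v \<le> real \<bar>n\<bar>\<^sub>v / 2"
    and "normal_index (shifted_system \<omega> (2 * \<bar>n\<bar>\<^sub>v - 4 * \<bar>j\<bar>\<^sub>v)) (2 *s j)"
    and "is_type_I (shifted_system \<omega> (2 * \<bar>n\<bar>\<^sub>v - 4 * \<bar>j\<bar>\<^sub>v)) (2 *s j) q"
    and "is_basis_family Y
           {1..dim (harmonic_polynomials (\<bar>n\<bar>\<^sub>v - 2 * \<bar>j\<bar>\<^sub>v) :: (real ^ 2 \<Rightarrow> real) set)}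
           (harmonic_polynomials (\<bar>n\<bar>\<^sub>v - 2 * \<bar>j\<bar>\<^sub>v))"
    and "\<nu> \<in> {1..dim (harmonic_polynomials (\<bar>n\<bar>\<^sub>v - 2 * \<bar>j\<bar>\<^sub>v) :: (real ^ 2 \<Rightarrow> real) set)}"
    and "int \<bar>a\<bar>\<^sub>v < int \<bar>n\<bar>\<^sub>v - 1"
  shows "has_bochner_integral lborel
           (\<lambda>x. \<Sum>l\<in>UNIV. (poly (q l) (norm x) * Y \<nu> x) * monomial a x * W l x) 0"
proof -
  define m where "m = \<bar>n\<bar>\<^sub>v - 2 * \<bar>j\<bar>\<^sub>v"
  have jn: "2 * \<bar>j\<bar>\<^sub>v \<le> \<bar>n\<bar>\<^sub>v"
    using assms(2) by linarith
  then have k: "2 * \<bar>n\<bar>\<^sub>v - 4 * \<bar>j\<bar>\<^sub>v = 2 * m"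
    by (simp add: m_def)
  have size: "\<bar>2 *s j\<bar>\<^sub>v = 2 * \<bar>j\<bar>\<^sub>v"
    by (simp add: vec_size_def sum_distrib_left)
  have YH: "Y \<nu> \<in> harmonic_polynomials m"
    using span_base[OF imageI[OF assms(6), of Y]] assms(5)
    by (simp only: is_basis_family_def m_def)
  have YP: "Y \<nu> \<in> polynomial_functions"
    using YH homogeneous_imp_polynomial by (auto simp: harmonic_polynomials_def)
  have Q: "monomial a \<in> homogeneous_polynomials \<bar>a\<bar>\<^sub>v"
    by (simp add: monomial_in_homogeneous)
  have P: "(\<lambda>x. Y \<nu> x * monomial a x) \<in> polynomial_functions"
    by (intro polynomial_mult YP homogeneous_imp_polynomial[OF Q])
  \<comment> \<open>The absolute value makes \<open>\<phi> l\<close> measurable on the whole line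
    and changes nothing at \<open>norm x\<close> or on \<open>{0..}\<close>.\<close>
  define \<phi> where "\<phi> l \<rho> = poly (q l) \<rho> * \<omega> l \<bar>\<rho>\<bar>" for l \<rho>
  have meas: "\<phi> l \<in> borel_measurable borel" for l
    unfolding \<phi>_def[abs_def]
    by (intro borel_measurable_times radial_weight_profile_measurable[OF assms(1)]
        borel_measurable_continuous_onI continuous_intros)
  have W: "weight_function (W l)" "W l x = \<omega> l (norm x)" for l x
    using assms(1) by (auto simp: radial_weight_def)
  have eq: "(poly (q l) (norm x) * Y \<nu> x) * monomial a x * W l x =
      \<phi> l (norm x) * (Y \<nu> x * monomial a x)" for l x
    by (simp add: \<phi>_def W(2))
  have int: "integrable lborel (\<lambda>x. \<phi> l (norm x) * (Y \<nu> x * monomial a x))" for l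
    using weight_integrable_poly_norm[OF W(1) P, of "q l" l] unfolding eq[symmetric]
    by (simp add: mult.assoc)
  \<comment> \<open>One \<open>C\<close> serves all \<open>l\<close>, because it depends only on
    \<open>Y \<nu>\<close> and \<open>monomial a\<close>; it therefore factors out of the sum over
    \<open>l\<close>. The exponent ends in \<open>+ 1\<close> since
    \<open>CARD(2) - 1 = 1\<close>.\<close>
  obtain C where C: "(LINT x|lborel. \<phi> l (norm x) * (Y \<nu> x * monomial a x)) =
      C * (LINT \<rho>:{0..}|lborel. \<phi> l \<rho> * \<rho> ^ (m + \<bar>a\<bar>\<^sub>v + 1))"
    and C0: "\<bar>a\<bar>\<^sub>v < m \<Longrightarrow> C = 0" for l
  proof (rule harmonic_radial_integral[OF YH Q])
    fix C assume "\<And>\<phi> :: real \<Rightarrow> real. \<phi> \<in> borel_measurable borel \<Longrightarrow>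
      integrable lborel (\<lambda>x. \<phi> (norm x) * (Y \<nu> x * monomial a x)) \<Longrightarrow>
      (LINT x|lborel. \<phi> (norm x) * (Y \<nu> x * monomial a x)) =
        C * (LINT \<rho>:{0..}|lborel. \<phi> \<rho> * \<rho> ^ (m + \<bar>a\<bar>\<^sub>v + CARD(2) - 1))"
      and "\<bar>a\<bar>\<^sub>v < m \<Longrightarrow> C = 0"
    then show thesis
      using that[of C] meas int by simp
  qed
  have "C * (\<Sum>l\<in>UNIV. LINT \<rho>:{0..}|lborel. \<phi> l \<rho> * \<rho> ^ (m + \<bar>a\<bar>\<^sub>v + 1)) = 0"
  proof (cases "\<bar>a\<bar>\<^sub>v < m")
    case True
    then show ?thesis
      using C0 by simp
  next
    case False
    \<comment> \<open>The shifted weight already carries \<open>\<rho> ^ (2 * m + 1)\<close>;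
      \<open>t\<close> is what remains of the exponent
      \<open>m + \<bar>a\<bar>\<^sub>v + 1\<close>.\<close>
    define t where "t = \<bar>a\<bar>\<^sub>v - m"
    \<comment> \<open>From \<open>\<bar>a\<bar>\<^sub>v < \<bar>n\<bar>\<^sub>v - 1\<close> follows
      \<open>t < 2 * \<bar>j\<bar>\<^sub>v - 1\<close>, strictly below the one exponent at which the
      Type I relation has value 1.\<close>
    have t: "t < \<bar>2 *s j\<bar>\<^sub>v" "t \<noteq> \<bar>2 *s j\<bar>\<^sub>v - 1"
      using False assms(7) jn unfolding size t_def m_def by linarith+
    have exponent: "m + \<bar>a\<bar>\<^sub>v + 1 = t + (2 * m + 1)"
      using False by (simp add: t_def)
    have "(LINT \<rho>:{0..}|lborel. \<phi> l \<rho> * \<rho> ^ (m + \<bar>a\<bar>\<^sub>v + 1)) =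
        (LINT \<rho>:{0..}|lborel. poly (q l) \<rho> * \<rho> ^ t * shifted_system \<omega> (2 * m) l \<rho>)" for l
      unfolding exponent
      by (intro set_lebesgue_integral_cong) (auto simp: \<phi>_def shifted_system_def power_add)
    moreover have "(\<Sum>l\<in>UNIV. LINT \<rho>:{0..}|lborel.
        poly (q l) \<rho> * \<rho> ^ t * shifted_system \<omega> (2 * m) l \<rho>) = 0"
      using assms(4) t unfolding k is_type_I_def by auto
    ultimately show ?thesis
      by simp
  qed
  then have "(LINT x|lborel. (\<Sum>l\<in>UNIV. \<phi> l (norm x) * (Y \<nu> x * monomial a x))) = 0"
    by (subst Bochner_Integration.integral_sum) (simp_all only: int C sum_distrib_left)
  then show ?thesis
    unfolding eq has_bochner_integral_iff
    by (intro conjI Bochner_Integration.integrable_sum int)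
qed

end
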